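(* Let $\mathcal{C}$ be an additive category such that every morphism has a pseudokernel and a pseudocokernel. Let $\mathcal{B}$ be a (full) subcategory of $\mathcal{C}$. Consider the following sentences: (1) $\mathcal{B}$ is a reflective subcategory of $\mathcal{C}$. (2) $\mathcal{B}$ is preenveloping, closed under taking direct summands, and every morphism in $\mathcal{B}$ has a pseudokernel in $\mathcal{C}$ which belongs to $\mathcal{B}$. Then (1) implies (2). If $\mathcal{C}$ has split idempotents, then (2) implies (1) as well.
   Context: All subcategories are full and closed under isomorphisms. A subcategory $\mathcal{B}$ of $\mathcal{C}$ is reflective if the inclusion functor $\mathcal{B}\to\mathcal{C}$ has a left adjoint. A pseudokernel of $f:A\to B$ is a morphism $k:K\to A$ with $fk=0$ such that every $k':K'\to A$ with $fk'=0$ factors (not necessarily uniquely) through $k$. Dually, a pseudocokernel of $f:A\to B$ is a morphism $c:B\to C$ with $cf=0$ such that every $c':B\to C'$ with $c'f=0$ factors (not necessarily uniquely) through $c$. A pseudokernel $k:K\to A$ "belongs to $\mathcal{B}$" if $K\in\mathcal{B}$. A $\mathcal{B}$-preenvelope of an object $A$ is a morphism $f:A\to B$ with $B\in\mathcal{B}$ such that $\mathcal{C}(f,B'):\mathcal{C}(B,B')\to\mathcal{C}(A,B')$ is surjective for every $B'\in\mathcal{B}$; $\mathcal{B}$ is preenveloping if every object of $\mathcal{C}$ has a $\mathcal{B}$-preenvelope. $\mathcal{C}$ has split idempotents if for every idempotent $e\in\mathcal{C}(A,A)$ there are morphisms $p:A\to B$, $i:B\to A$ with $pi=1_B$ and $ip=e$.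 *)

theory Defs
  imports "HOL-Algebra.Group"
begin

record ('o, 'm) cat =
  Obj :: "'o set"
  Arr :: "'m set"
  Dom :: "'m \<Rightarrow> 'o"
  Cod :: "'m \<Rightarrow> 'o"
  Id :: "'o \<Rightarrow> 'm"
  Comp :: "'m \<Rightarrow> 'm \<Rightarrow> 'm" (infixr "\<cdot>\<index>" 70)

definition Hom :: "('o, 'm, 'r) cat_scheme \<Rightarrow> 'o \<Rightarrow> 'o \<Rightarrow> 'm set" where
  "Hom C A B = {f \<in> Arr C. Dom C f = A \<and> Cod C f = B}"

locale category =
  fixes C :: "('o, 'm, 'r) cat_scheme" (structure)
  assumes Dom_Obj: "f \<in> Arr C \<Longrightarrow> Dom C f \<in> Obj C"
    and Cod_Obj: "f \<in> Arr C \<Longrightarrow> Cod C f \<in> Obj C"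
    and Id_Hom: "A \<in> Obj C \<Longrightarrow> Id C A \<in> Hom C A A"
    and Comp_Hom: "\<lbrakk>f \<in> Hom C A B; g \<in> Hom C B D\<rbrakk> \<Longrightarrow> g \<cdot> f \<in> Hom C A D"
    and Comp_Id: "f \<in> Hom C A B \<Longrightarrow> f \<cdot> Id C A = f"
    and Id_Comp: "f \<in> Hom C A B \<Longrightarrow> Id C B \<cdot> f = f"
    and Comp_assoc: "\<lbrakk>f \<in> Hom C A B; g \<in> Hom C B D; h \<in> Hom C D E\<rbrakk>
      \<Longrightarrow> (h \<cdot> g) \<cdot> f = h \<cdot> (g \<cdot> f)"

definition isomorphic :: "('o, 'm, 'r) cat_scheme \<Rightarrow> 'o \<Rightarrow> 'o \<Rightarrow> bool" where
  "isomorphic C A B \<longleftrightarrow>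
    (\<exists>f \<in> Hom C A B. \<exists>g \<in> Hom C B A. g \<cdot>\<^bsub>C\<^esub> f = Id C A \<and> f \<cdot>\<^bsub>C\<^esub> g = Id C B)"


subsection \<open>Functors and adjunctions\<close>

record ('o1, 'm1, 'o2, 'm2) cat_map =
  ObjMap :: "'o1 \<Rightarrow> 'o2"
  ArrMap :: "'m1 \<Rightarrow> 'm2"

locale cat_functor = source: category C + target: category D
  for C :: "('o1, 'm1, 'r1) cat_scheme" and D :: "('o2, 'm2, 'r2) cat_scheme"
    and F :: "('o1, 'm1, 'o2, 'm2) cat_map" +
  assumes ObjMap_Obj: "A \<in> Obj C \<Longrightarrow> ObjMap F A \<in> Obj D"
    and ArrMap_Hom: "f \<in> Hom C A B \<Longrightarrow> ArrMap F f \<in> Hom D (ObjMap F A) (ObjMap F B)"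
    and ArrMap_Id: "A \<in> Obj C \<Longrightarrow> ArrMap F (Id C A) = Id D (ObjMap F A)"
    and ArrMap_Comp: "\<lbrakk>f \<in> Hom C A B; g \<in> Hom C B E\<rbrakk>
      \<Longrightarrow> ArrMap F (g \<cdot>\<^bsub>C\<^esub> f) = ArrMap F g \<cdot>\<^bsub>D\<^esub> ArrMap F f"

text \<open>\<open>\<phi> A X\<close> is the bijection from \<open>D(L A, X)\<close> to \<open>C(A, R X)\<close>, natural in both arguments.\<close>

definition left_adjoint ::
  "('o1, 'm1, 'r1) cat_scheme \<Rightarrow> ('o2, 'm2, 'r2) cat_scheme
    \<Rightarrow> ('o1, 'm1, 'o2, 'm2) cat_map \<Rightarrow> ('o2, 'm2, 'o1, 'm1) cat_map \<Rightarrow> bool" where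
  "left_adjoint C D L R \<longleftrightarrow>
    cat_functor C D L \<and> cat_functor D C R \<and>
    (\<exists>\<phi>. (\<forall>A \<in> Obj C. \<forall>X \<in> Obj D.
            bij_betw (\<phi> A X) (Hom D (ObjMap L A) X) (Hom C A (ObjMap R X))) \<and>
         (\<forall>A \<in> Obj C. \<forall>A' \<in> Obj C. \<forall>X \<in> Obj D. \<forall>X' \<in> Obj D.
            \<forall>f \<in> Hom C A' A. \<forall>g \<in> Hom D X X'. \<forall>h \<in> Hom D (ObjMap L A) X.
              \<phi> A' X' (g \<cdot>\<^bsub>D\<^esub> h \<cdot>\<^bsub>D\<^esub> ArrMap L f) = ArrMap R g \<cdot>\<^bsub>C\<^esub> \<phi> A X h \<cdot>\<^bsub>C\<^esub> f))"


subsection \<open>Full subcategories\<close>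

text \<open>Full subcategories closed under isomorphisms are represented by their sets of objects.\<close>

definition replete :: "('o, 'm, 'r) cat_scheme \<Rightarrow> 'o set \<Rightarrow> bool" where
  "replete C \<B> \<longleftrightarrow> \<B> \<subseteq> Obj C \<and> (\<forall>B \<in> \<B>. \<forall>A \<in> Obj C. isomorphic C A B \<longrightarrow> A \<in> \<B>)"

definition full_subcategory ::
  "('o, 'm, 'r) cat_scheme \<Rightarrow> 'o set \<Rightarrow> ('o, 'm, 'r) cat_scheme" where
  "full_subcategory C \<B> =
    C\<lparr>Obj := \<B>, Arr := {f \<in> Arr C. Dom C f \<in> \<B> \<and> Cod C f \<in> \<B>}\<rparr>"

definition inclusion :: "('o, 'm, 'o, 'm) cat_map" where
  "inclusion = \<lparr>ObjMap = (\<lambda>A. A), ArrMap = (\<lambda>f. f)\<rparr>"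

definition reflective :: "('o, 'm, 'r) cat_scheme \<Rightarrow> 'o set \<Rightarrow> bool" where
  "reflective C \<B> \<longleftrightarrow> (\<exists>L. left_adjoint C (full_subcategory C \<B>) L inclusion)"

lemma full_subcategory_simps [simp]:
  "Obj (full_subcategory C \<B>) = \<B>"
  "Arr (full_subcategory C \<B>) = {f \<in> Arr C. Dom C f \<in> \<B> \<and> Cod C f \<in> \<B>}"
  "Dom (full_subcategory C \<B>) = Dom C"
  "Cod (full_subcategory C \<B>) = Cod C"
  "Id (full_subcategory C \<B>) = Id C"
  "Comp (full_subcategory C \<B>) = Comp C"
  by (simp_all add: full_subcategory_def)

lemma Hom_full_subcategory:
  "Hom (full_subcategory C \<B>) A B = (if A \<in> \<B> \<and> B \<in> \<B> then Hom C A B else {})"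
  by (auto simp: Hom_def)

lemma (in category) category_full_subcategory:
  assumes "\<B> \<subseteq> Obj C"
  shows "category (full_subcategory C \<B>)"
  using assms by unfold_locales
    (auto simp: Hom_full_subcategory split: if_splits
      intro: Id_Hom Comp_Hom Comp_Id Id_Comp Comp_assoc)

lemma (in category) cat_functor_inclusion:
  assumes "\<B> \<subseteq> Obj C"
  shows "cat_functor (full_subcategory C \<B>) C inclusion"
proof -
  interpret S: category "full_subcategory C \<B>"
    using assms by (rule category_full_subcategory)
  show ?thesis
    using assms by unfold_locales
      (auto simp: inclusion_def Hom_full_subcategory split: if_splits)
qed


subsection \<open>Additive categories\<close>

record ('o, 'm) add_cat = "('o, 'm) cat" +
  Add :: "'m \<Rightarrow> 'm \<Rightarrow> 'm" (infixl "\<boxplus>\<index>" 65)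
  Zero :: "'o \<Rightarrow> 'o \<Rightarrow> 'm"

definition Hom_group :: "('o, 'm, 'r) add_cat_scheme \<Rightarrow> 'o \<Rightarrow> 'o \<Rightarrow> 'm monoid" where
  "Hom_group C A B = \<lparr>carrier = Hom C A B, monoid.mult = Add C, one = Zero C A B\<rparr>"

locale preadditive_category = category C
  for C :: "('o, 'm, 'r) add_cat_scheme" (structure) +
  assumes Hom_comm_group: "\<lbrakk>A \<in> Obj C; B \<in> Obj C\<rbrakk> \<Longrightarrow> comm_group (Hom_group C A B)"
    and Comp_Add: "\<lbrakk>f \<in> Hom C A B; f' \<in> Hom C A B; g \<in> Hom C B D\<rbrakk>
      \<Longrightarrow> g \<cdot> (f \<boxplus> f') = (g \<cdot> f) \<boxplus> (g \<cdot> f')"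
    and Add_Comp: "\<lbrakk>f \<in> Hom C A B; g \<in> Hom C B D; g' \<in> Hom C B D\<rbrakk>
      \<Longrightarrow> (g \<boxplus> g') \<cdot> f = (g \<cdot> f) \<boxplus> (g' \<cdot> f)"

definition zero_object :: "('o, 'm, 'r) cat_scheme \<Rightarrow> 'o \<Rightarrow> bool" where
  "zero_object C Z \<longleftrightarrow> Z \<in> Obj C \<and>
    (\<forall>A \<in> Obj C. (\<exists>!f. f \<in> Hom C Z A) \<and> (\<exists>!f. f \<in> Hom C A Z))"

definition biproduct :: "('o, 'm, 'r) add_cat_scheme \<Rightarrow> 'o \<Rightarrow> 'o \<Rightarrow> 'o \<Rightarrow> bool" where
  "biproduct C A B S \<longleftrightarrow> A \<in> Obj C \<and> B \<in> Obj C \<and> S \<in> Obj C \<and>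
    (\<exists>i \<in> Hom C A S. \<exists>j \<in> Hom C B S. \<exists>p \<in> Hom C S A. \<exists>q \<in> Hom C S B.
      p \<cdot>\<^bsub>C\<^esub> i = Id C A \<and> q \<cdot>\<^bsub>C\<^esub> j = Id C B \<and>
      p \<cdot>\<^bsub>C\<^esub> j = Zero C B A \<and> q \<cdot>\<^bsub>C\<^esub> i = Zero C A B \<and>
      (i \<cdot>\<^bsub>C\<^esub> p) \<boxplus>\<^bsub>C\<^esub> (j \<cdot>\<^bsub>C\<^esub> q) = Id C S)"

locale additive_category = preadditive_category C
  for C :: "('o, 'm, 'r) add_cat_scheme" (structure) +
  assumes ex_zero_object: "\<exists>Z. zero_object C Z"
    and ex_biproduct: "\<lbrakk>A \<in> Obj C; B \<in> Obj C\<rbrakk> \<Longrightarrow> \<exists>S. biproduct C A B S"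

definition pseudokernel :: "('o, 'm, 'r) add_cat_scheme \<Rightarrow> 'm \<Rightarrow> 'm \<Rightarrow> bool" where
  "pseudokernel C f k \<longleftrightarrow> f \<in> Arr C \<and> k \<in> Arr C \<and> Cod C k = Dom C f \<and>
    f \<cdot>\<^bsub>C\<^esub> k = Zero C (Dom C k) (Cod C f) \<and>
    (\<forall>K' \<in> Obj C. \<forall>k' \<in> Hom C K' (Dom C f). f \<cdot>\<^bsub>C\<^esub> k' = Zero C K' (Cod C f) \<longrightarrow>
      (\<exists>u \<in> Hom C K' (Dom C k). k \<cdot>\<^bsub>C\<^esub> u = k'))"

definition pseudocokernel :: "('o, 'm, 'r) add_cat_scheme \<Rightarrow> 'm \<Rightarrow> 'm \<Rightarrow> bool" where
  "pseudocokernel C f c \<longleftrightarrow> f \<in> Arr C \<and> c \<in> Arr C \<and> Dom C c = Cod C f \<and>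
    c \<cdot>\<^bsub>C\<^esub> f = Zero C (Dom C f) (Cod C c) \<and>
    (\<forall>C' \<in> Obj C. \<forall>c' \<in> Hom C (Cod C f) C'. c' \<cdot>\<^bsub>C\<^esub> f = Zero C (Dom C f) C' \<longrightarrow>
      (\<exists>u \<in> Hom C (Cod C c) C'. u \<cdot>\<^bsub>C\<^esub> c = c'))"

definition preenvelope :: "('o, 'm, 'r) cat_scheme \<Rightarrow> 'o set \<Rightarrow> 'o \<Rightarrow> 'm \<Rightarrow> bool" where
  "preenvelope C \<B> A f \<longleftrightarrow> (\<exists>B \<in> \<B>. f \<in> Hom C A B \<and>
    (\<forall>B' \<in> \<B>. (\<lambda>h. h \<cdot>\<^bsub>C\<^esub> f) ` Hom C B B' = Hom C A B'))"

definition preenveloping :: "('o, 'm, 'r) cat_scheme \<Rightarrow> 'o set \<Rightarrow> bool" where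
  "preenveloping C \<B> \<longleftrightarrow> (\<forall>A \<in> Obj C. \<exists>f. preenvelope C \<B> A f)"

text \<open>A direct summand comes with a complement; without split idempotents this is more than
  being a retract.\<close>

definition direct_summand :: "('o, 'm, 'r) add_cat_scheme \<Rightarrow> 'o \<Rightarrow> 'o \<Rightarrow> bool" where
  "direct_summand C A S \<longleftrightarrow> (\<exists>A'. biproduct C A A' S)"

definition closed_under_direct_summands ::
  "('o, 'm, 'r) add_cat_scheme \<Rightarrow> 'o set \<Rightarrow> bool" where
  "closed_under_direct_summands C \<B> \<longleftrightarrow> (\<forall>S \<in> \<B>. \<forall>A. direct_summand C A S \<longrightarrow> A \<in> \<B>)"

definition split_idempotents :: "('o, 'm, 'r) cat_scheme \<Rightarrow> bool" where
  "split_idempotents C \<longleftrightarrow>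
    (\<forall>A \<in> Obj C. \<forall>e \<in> Hom C A A. e \<cdot>\<^bsub>C\<^esub> e = e \<longrightarrow>
      (\<exists>B \<in> Obj C. \<exists>p \<in> Hom C A B. \<exists>i \<in> Hom C B A.
        p \<cdot>\<^bsub>C\<^esub> i = Id C B \<and> i \<cdot>\<^bsub>C\<^esub> p = e))"

end

theory Submission
  imports Defs
begin

text \<open>
  Being reflective means that every object \<open>A\<close> has a universal arrow \<open>r : A \<rightarrow> R\<close> to \<open>\<B>\<close>.

  Given universal arrows, a retract \<open>A\<close> of an object of \<open>\<B>\<close> has \<open>r\<close> as a split monomorphism, which
  universality makes an isomorphism; and a pseudokernel \<open>k : K \<rightarrow> X\<close> of a morphism of \<open>\<B>\<close> extends
  along the universal arrow of \<open>K\<close> to a pseudokernel in \<open>\<B>\<close>.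

  Conversely, take a preenvelope \<open>f : A \<rightarrow> B\<close>, a pseudocokernel \<open>c\<close> of \<open>f\<close>, a preenvelope \<open>g\<close> of the
  codomain of \<open>c\<close> and a pseudokernel \<open>k : K \<rightarrow> B\<close> of \<open>g c\<close> with \<open>K \<in> \<B>\<close>. Then \<open>f = k f'\<close>, and every
  morphism from \<open>B\<close> to \<open>\<B>\<close> that kills \<open>f\<close> factors through \<open>g c\<close> and hence kills \<open>k\<close>. Writing
  \<open>f' = s f\<close>, the endomorphism \<open>e = s k\<close> of \<open>K\<close> fixes \<open>f'\<close>, and any morphism from \<open>K\<close> to \<open>\<B>\<close> that
  kills \<open>f'\<close> also kills \<open>e\<close>. So \<open>1 - e\<close> kills \<open>e\<close>, that is, \<open>e\<close> is idempotent, and splitting it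
  gives the universal arrow.
\<close>

subsection \<open>Universal arrows to a full subcategory\<close>

definition universal_arrow :: "('o, 'm, 'r) cat_scheme \<Rightarrow> 'o set \<Rightarrow> 'o \<Rightarrow> 'o \<Rightarrow> 'm \<Rightarrow> bool" where
  "universal_arrow C \<B> A R r \<longleftrightarrow> R \<in> \<B> \<and> r \<in> Hom C A R \<and>
    (\<forall>X \<in> \<B>. \<forall>f \<in> Hom C A X. \<exists>!g. g \<in> Hom C R X \<and> g \<cdot>\<^bsub>C\<^esub> r = f)"

lemma universal_arrowD:
  assumes "universal_arrow C \<B> A R r"
  shows "R \<in> \<B>" "r \<in> Hom C A R"
  using assms by (auto simp: universal_arrow_def)

lemma universal_arrow_factor:
  assumes "universal_arrow C \<B> A R r" "X \<in> \<B>" "f \<in> Hom C A X"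
  obtains g where "g \<in> Hom C R X" "g \<cdot>\<^bsub>C\<^esub> r = f"
  using assms unfolding universal_arrow_def by blast

lemma inclusion_simps [simp]: "ObjMap inclusion A = A" "ArrMap inclusion f = f"
  by (simp_all add: inclusion_def)

context category
begin

lemma Hom_Obj:
  assumes "f \<in> Hom C A B"
  shows "A \<in> Obj C" "B \<in> Obj C"
  using assms Dom_Obj Cod_Obj by (auto simp: Hom_def)

lemma universal_arrow_cancel:
  assumes "universal_arrow C \<B> A R r" "X \<in> \<B>" "g \<in> Hom C R X" "h \<in> Hom C R X"
    and "g \<cdot> r = h \<cdot> r"
  shows "g = h"
proof -
  have "g \<cdot> r \<in> Hom C A X"
    using assms universal_arrowD(2) Comp_Hom by metis
  then have "\<exists>!u. u \<in> Hom C R X \<and> u \<cdot> r = g \<cdot> r"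
    using assms(1,2) unfolding universal_arrow_def by blast
  then show ?thesis
    using assms by metis
qed

lemma universal_arrow_image:
  assumes U: "universal_arrow C \<B> A R r" and X: "X \<in> \<B>"
  shows "(\<lambda>g. g \<cdot> r) ` Hom C R X = Hom C A X"
proof (intro equalityI subsetI)
  fix f assume "f \<in> (\<lambda>g. g \<cdot> r) ` Hom C R X"
  then show "f \<in> Hom C A X"
    using Comp_Hom[OF universal_arrowD(2)[OF U]] by auto
next
  fix f assume "f \<in> Hom C A X"
  then obtain g where "g \<in> Hom C R X" "g \<cdot> r = f"
    using universal_arrow_factor[OF U X] by metis
  then show "f \<in> (\<lambda>g. g \<cdot> r) ` Hom C R X"
    by blast
qed

section \<open>Reflectivity as existence of universal arrows\<close>

text \<open>The universal arrow is the unit of the adjunction, the image of the identity of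
  \<open>ObjMap L A\<close> under \<open>\<phi>\<close>. By a Yoneda argument \<open>\<phi>\<close>
  is precomposition with it, so bijectivity of \<open>\<phi>\<close> is the universal
  property.\<close>

lemma reflective_imp_universal_arrow:
  assumes "reflective C \<B>" "A \<in> Obj C"
  shows "\<exists>R r. universal_arrow C \<B> A R r"
proof -
  let ?D = "full_subcategory C \<B>"
  from assms(1) obtain L \<phi> where L: "cat_functor C ?D L"
    and bij: "\<And>A X. \<lbrakk>A \<in> Obj C; X \<in> \<B>\<rbrakk> \<Longrightarrow> bij_betw (\<phi> A X) (Hom ?D (ObjMap L A) X) (Hom C A X)"
    and nat: "\<And>A A' X X' f g h. \<lbrakk>A \<in> Obj C; A' \<in> Obj C; X \<in> \<B>; X' \<in> \<B>;
        f \<in> Hom C A' A; g \<in> Hom ?D X X'; h \<in> Hom ?D (ObjMap L A) X\<rbrakk>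
      \<Longrightarrow> \<phi> A' X' (g \<cdot> h \<cdot> ArrMap L f) = g \<cdot> \<phi> A X h \<cdot> f"
    unfolding reflective_def left_adjoint_def by simp (elim exE conjE, blast)
  interpret L: cat_functor C ?D L by (rule L)
  let ?R = "ObjMap L A"
  let ?r = "\<phi> A ?R (Id C ?R)"
  have R: "?R \<in> \<B>"
    using L.ObjMap_Obj[OF assms(2)] by simp
  have Id: "Id C ?R \<in> Hom ?D ?R ?R"
    using L.target.Id_Hom[of ?R] R by simp
  have r: "?r \<in> Hom C A ?R"
    using bij_betwE[OF bij[OF assms(2) R]] Id by blast
  have D: "Hom ?D ?R X = Hom C ?R X" if "X \<in> \<B>" for X
    using R that by (simp add: Hom_full_subcategory)
  \<comment> \<open>This is naturality evaluated at the identity of \<open>?R\<close>, with the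
    identity of \<open>A\<close> in the contravariant argument.\<close>
  have \<phi>: "\<phi> A X g = g \<cdot> ?r" if X: "X \<in> \<B>" and g: "g \<in> Hom C ?R X" for X g
  proof -
    have "ArrMap L (Id C A) = Id C ?R"
      using L.ArrMap_Id[OF assms(2)] by simp
    moreover have "Id C ?R \<cdot> Id C ?R = Id C ?R"
      using Id_Comp Id D[OF R] by simp
    ultimately have "\<phi> A X g = g \<cdot> ?r \<cdot> Id C A"
      using nat[OF assms(2) assms(2) R X Id_Hom[OF assms(2)], of g "Id C ?R"] Id g D[OF X]
        Comp_Id[OF g] by simp
    then show ?thesis
      using Comp_Id[OF r] by simp
  qed
  have "\<exists>!g. g \<in> Hom C ?R X \<and> g \<cdot> ?r = f" if X: "X \<in> \<B>" and f: "f \<in> Hom C A X" for X f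
  proof -
    have "bij_betw (\<phi> A X) (Hom C ?R X) (Hom C A X)"
      using bij[OF assms(2) X] D[OF X] by simp
    then have "bij_betw (\<lambda>g. g \<cdot> ?r) (Hom C ?R X) (Hom C A X)"
      using iffD1[OF bij_betw_cong[of "Hom C ?R X" "\<phi> A X" "\<lambda>g. g \<cdot> ?r"]] \<phi>[OF X] by simp
    then have inj: "inj_on (\<lambda>g. g \<cdot> ?r) (Hom C ?R X)"
      and "f \<in> (\<lambda>g. g \<cdot> ?r) ` Hom C ?R X"
      using f by (simp_all add: bij_betw_def)
    then obtain g where "g \<in> Hom C ?R X" "g \<cdot> ?r = f"
      by blast
    then show ?thesis
      using inj_onD[OF inj] by (intro ex1I[of _ g]) simp_all
  qed
  then have "universal_arrow C \<B> A ?R ?r"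
    using R r unfolding universal_arrow_def by blast
  then show ?thesis
    by blast
qed

text \<open>Chosen universal arrows \<open>r A\<close> define a left adjoint: uniqueness of
  extensions gives functoriality, and precomposition with \<open>r A\<close> is the natural
  bijection.\<close>

lemma universal_arrows_imp_reflective:
  assumes "\<B> \<subseteq> Obj C" and "\<And>A. A \<in> Obj C \<Longrightarrow> \<exists>R r. universal_arrow C \<B> A R r"
  shows "reflective C \<B>"
proof -
  let ?D = "full_subcategory C \<B>"
  obtain R r where U: "universal_arrow C \<B> A (R A) (r A)" if "A \<in> Obj C" for A
    using assms(2) by metis
  note R = universal_arrowD(1)[OF U] and r = universal_arrowD(2)[OF U]
  \<comment> \<open>\<open>M f\<close> is to be the unique map making the square with
    \<open>r\<close> commute. The choice operator makes \<open>M\<close> total; only its values on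
    arrows matter.\<close>
  define M where "M f = (SOME u. u \<in> Hom C (R (Dom C f)) (R (Cod C f)) \<and>
    u \<cdot> r (Dom C f) = r (Cod C f) \<cdot> f)" for f
  have M: "M f \<in> Hom C (R A) (R B) \<and> M f \<cdot> r A = r B \<cdot> f" if f: "f \<in> Hom C A B" for f A B
  proof -
    note AB = Hom_Obj[OF f]
    have "r B \<cdot> f \<in> Hom C A (R B)"
      using Comp_Hom f r AB by blast
    then have "\<exists>u. u \<in> Hom C (R A) (R B) \<and> u \<cdot> r A = r B \<cdot> f"
      using universal_arrow_factor[OF U R] AB by metis
    from someI_ex[OF this] show ?thesis
      using f by (simp add: M_def Hom_def)
  qed
  have M_unique: "M f = u" if "f \<in> Hom C A B" "u \<in> Hom C (R A) (R B)" "u \<cdot> r A = r B \<cdot> f"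
    for f A B u
    using universal_arrow_cancel[OF U R] M[OF that(1)] that Hom_Obj[OF that(1)] by metis
  define L where "L = \<lparr>ObjMap = R, ArrMap = M\<rparr>"
  have [simp]: "ObjMap L A = R A" "ArrMap L f = M f" for A f
    by (simp_all add: L_def)
  interpret D: category ?D
    using assms(1) by (rule category_full_subcategory)
  have functor_L: "cat_functor C ?D L"
  proof
    show "ObjMap L A \<in> Obj ?D" if "A \<in> Obj C" for A
      using R[OF that] by simp
    show "ArrMap L f \<in> Hom ?D (ObjMap L A) (ObjMap L B)" if "f \<in> Hom C A B" for f A B
      using M[OF that] R Hom_Obj[OF that] by (simp add: Hom_full_subcategory)
    show "ArrMap L (Id C A) = Id ?D (ObjMap L A)" if A: "A \<in> Obj C" for A
      using M_unique[OF Id_Hom[OF A] Id_Hom] R[OF A] assms(1) Id_Comp[OF r[OF A]] Comp_Id[OF r[OF A]]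
      by auto
    show "ArrMap L (g \<cdot> f) = ArrMap L g \<cdot>\<^bsub>?D\<^esub> ArrMap L f"
      if f: "f \<in> Hom C A B" and g: "g \<in> Hom C B E" for f g A B E
    proof -
      note Obs = Hom_Obj[OF f] Hom_Obj[OF g]
      have "(M g \<cdot> M f) \<cdot> r A = M g \<cdot> (r B \<cdot> f)"
        using Comp_assoc[OF r] M[OF f] M[OF g] Obs by metis
      also have "\<dots> = r E \<cdot> (g \<cdot> f)"
        using Comp_assoc[OF f r] Comp_assoc[OF f g r] M[OF g] Obs by metis
      finally have "M (g \<cdot> f) = M g \<cdot> M f"
        using M_unique Comp_Hom M f g by blast
      then show ?thesis
        by simp
    qed
  qed
  let ?\<phi> = "\<lambda>A X h. h \<cdot> r A"
  have "bij_betw (?\<phi> A X) (Hom ?D (ObjMap L A) X) (Hom C A (ObjMap inclusion X))"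
    if A: "A \<in> Obj C" and X: "X \<in> Obj ?D" for A X
  proof -
    have "inj_on (?\<phi> A X) (Hom C (R A) X)"
      using universal_arrow_cancel[OF U[OF A]] X by (auto intro!: inj_onI)
    moreover have "?\<phi> A X ` Hom C (R A) X = Hom C A X"
      using universal_arrow_image[OF U[OF A]] X by simp
    ultimately show ?thesis
      using R[OF A] X by (simp add: bij_betw_def Hom_full_subcategory)
  qed
  moreover have "?\<phi> A' X' (g \<cdot>\<^bsub>?D\<^esub> h \<cdot>\<^bsub>?D\<^esub> ArrMap L f) = ArrMap inclusion g \<cdot> ?\<phi> A X h \<cdot> f"
    if "A \<in> Obj C" "A' \<in> Obj C" and f: "f \<in> Hom C A' A"
      and "g \<in> Hom ?D X X'" "h \<in> Hom ?D (ObjMap L A) X" for A A' X X' f g h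
  proof -
    have g: "g \<in> Hom C X X'" and h: "h \<in> Hom C (R A) X"
      using that by (auto simp: Hom_full_subcategory split: if_splits)
    note Mf = M[OF f] and rA = r[OF that(1)] and rA' = r[OF that(2)]
    have "(g \<cdot> h \<cdot> M f) \<cdot> r A' = g \<cdot> (h \<cdot> M f) \<cdot> r A'"
      using Comp_assoc[OF rA' _ g] Comp_Hom[OF conjunct1[OF Mf] h] by blast
    also have "(h \<cdot> M f) \<cdot> r A' = h \<cdot> r A \<cdot> f"
      using Comp_assoc[OF rA' _ h] Mf by metis
    also have "h \<cdot> r A \<cdot> f = (h \<cdot> r A) \<cdot> f"
      using Comp_assoc[OF f rA h] by simp
    finally show ?thesis
      by simp
  qed
  ultimately have "left_adjoint C ?D L inclusion"
    unfolding left_adjoint_def using functor_L cat_functor_inclusion[OF assms(1)]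
    by (intro conjI exI[of _ ?\<phi>]) blast+
  then show ?thesis
    unfolding reflective_def by blast
qed

section \<open>Preenvelopes and retracts\<close>

lemma preenveloping_if_universal_arrows:
  assumes "\<And>A. A \<in> Obj C \<Longrightarrow> \<exists>R r. universal_arrow C \<B> A R r"
  shows "preenveloping C \<B>"
proof -
  have "preenvelope C \<B> A r" if "universal_arrow C \<B> A R r" for A R r
    using universal_arrowD[OF that] universal_arrow_image[OF that] unfolding preenvelope_def by blast
  then show ?thesis
    using assms unfolding preenveloping_def by blast
qed

text \<open>Extending \<open>i\<close> along \<open>r\<close> to \<open>j\<close> makes
  \<open>t = p j\<close> a left inverse of \<open>r\<close>. Since \<open>r t\<close> and the
  identity of \<open>R\<close> agree after precomposition with \<open>r\<close>, they are equal, so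
  \<open>A\<close> is isomorphic to \<open>R\<close>.\<close>

lemma universal_arrow_retract:
  assumes "replete C \<B>" "universal_arrow C \<B> A R r" "S \<in> \<B>"
    and i: "i \<in> Hom C A S" and p: "p \<in> Hom C S A" and pi: "p \<cdot> i = Id C A"
  shows "A \<in> \<B>"
proof -
  note R = universal_arrowD(1)[OF assms(2)] and r = universal_arrowD(2)[OF assms(2)]
  obtain j where j: "j \<in> Hom C R S" "j \<cdot> r = i"
    using universal_arrow_factor[OF assms(2,3) i] .
  define t where "t = p \<cdot> j"
  have t: "t \<in> Hom C R A"
    unfolding t_def using Comp_Hom j p by blast
  have tr: "t \<cdot> r = Id C A"
    unfolding t_def using Comp_assoc[OF r j(1) p] j pi by simp
  have RO: "R \<in> Obj C"
    using Hom_Obj r by blast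
  have "(r \<cdot> t) \<cdot> r = Id C R \<cdot> r"
    using Comp_assoc[OF r t r] tr Comp_Id[OF r] Id_Comp[OF r] by simp
  then have "r \<cdot> t = Id C R"
    using universal_arrow_cancel[OF assms(2) R Comp_Hom[OF t r] Id_Hom[OF RO]] by blast
  then have "isomorphic C A R"
    unfolding isomorphic_def using r t tr by blast
  then show ?thesis
    using assms(1) R Hom_Obj[OF i] unfolding replete_def by blast
qed

lemma preenvelopeE:
  assumes "preenvelope C \<B> A f"
  obtains B where "B \<in> \<B>" "f \<in> Hom C A B"
    "\<And>X h. \<lbrakk>X \<in> \<B>; h \<in> Hom C A X\<rbrakk> \<Longrightarrow> \<exists>u \<in> Hom C B X. u \<cdot> f = h"
proof -
  from assms obtain B where B: "B \<in> \<B>" "f \<in> Hom C A B"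
    and surj: "\<forall>X \<in> \<B>. (\<lambda>h. h \<cdot> f) ` Hom C B X = Hom C A X"
    unfolding preenvelope_def by blast
  have "\<exists>u \<in> Hom C B X. u \<cdot> f = h" if "X \<in> \<B>" "h \<in> Hom C A X" for X h
  proof -
    have "h \<in> (\<lambda>h. h \<cdot> f) ` Hom C B X"
      using surj that by blast
    then show ?thesis
      by blast
  qed
  then show ?thesis
    using that B by blast
qed

end


subsection \<open>Subtraction of morphisms\<close>

context preadditive_category
begin

text \<open>The inverse \<open>m_inv\<close> needs the hom-group as an argument, so the group is
  recovered from the domain and codomain of \<open>f\<close>.\<close>

definition Sub :: "'m \<Rightarrow> 'm \<Rightarrow> 'm" where
  "Sub f g = f \<boxplus> m_inv (Hom_group C (Dom C f) (Cod C f)) g"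

lemma Zero_Hom: "\<lbrakk>A \<in> Obj C; B \<in> Obj C\<rbrakk> \<Longrightarrow> Zero C A B \<in> Hom C A B"
  using comm_group.axioms(2)[OF Hom_comm_group, of A B] group.is_monoid monoid.one_closed
  by (fastforce simp: Hom_group_def)

lemma Sub:
  assumes f: "f \<in> Hom C A B" and g: "g \<in> Hom C A B"
  shows Sub_Hom: "Sub f g \<in> Hom C A B" and Add_Sub: "g \<boxplus> Sub f g = f"
    and Sub_eq_Zero_iff: "Sub f g = Zero C A B \<longleftrightarrow> f = g"
    and Sub_unique: "\<And>u. \<lbrakk>u \<in> Hom C A B; g \<boxplus> u = f\<rbrakk> \<Longrightarrow> Sub f g = u"
proof -
  let ?G = "Hom_group C A B"
  interpret G: comm_group ?G
    using Hom_comm_group Hom_Obj[OF f] by blast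
  have [simp]: "carrier ?G = Hom C A B" "monoid.mult ?G = Add C" "one ?G = Zero C A B"
    by (simp_all add: Hom_group_def)
  have S: "Sub f g = f \<otimes>\<^bsub>?G\<^esub> inv\<^bsub>?G\<^esub> g"
    using f by (simp add: Sub_def Hom_def)
  have fg: "f \<in> carrier ?G" "g \<in> carrier ?G"
    using f g by simp_all
  show 1: "Sub f g \<in> Hom C A B"
    using G.m_closed[OF fg(1) G.inv_closed[OF fg(2)]] S by simp
  have "g \<otimes>\<^bsub>?G\<^esub> Sub f g = f"
    unfolding S using fg by (metis G.inv_closed G.m_closed G.m_comm G.inv_solve_right')
  then show 2: "g \<boxplus> Sub f g = f"
    by simp
  show u: "Sub f g = u" if "u \<in> Hom C A B" "g \<boxplus> u = f" for u
    using G.Units_l_cancel[of g "Sub f g" u] 1 2 that g G.Units_eq by simp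
  have "g \<boxplus> Zero C A B = g"
    using G.r_one[OF fg(2)] by simp
  then show "Sub f g = Zero C A B \<longleftrightarrow> f = g"
    using 2 u[of "Zero C A B"] G.one_closed by auto
qed

text \<open>By distributivity the left side solves
  \<open>(g \<cdot> f') \<boxplus> u = g \<cdot> f\<close>, an equation whose only solution is the
  right side.\<close>

lemma Comp_Sub:
  assumes f: "f \<in> Hom C A B" and f': "f' \<in> Hom C A B" and g: "g \<in> Hom C B D"
  shows "g \<cdot> Sub f f' = Sub (g \<cdot> f) (g \<cdot> f')"
  using Sub_unique[OF Comp_Hom[OF f g] Comp_Hom[OF f' g] Comp_Hom[OF Sub_Hom[OF f f'] g]]
    Comp_Add[OF f' Sub_Hom[OF f f'] g] Add_Sub[OF f f'] by simp

lemma Sub_Comp: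
  assumes f: "f \<in> Hom C A B" and g: "g \<in> Hom C B D" and g': "g' \<in> Hom C B D"
  shows "Sub g g' \<cdot> f = Sub (g \<cdot> f) (g' \<cdot> f)"
  using Sub_unique[OF Comp_Hom[OF f g] Comp_Hom[OF f g'] Comp_Hom[OF f Sub_Hom[OF g g']]]
    Add_Comp[OF f g' Sub_Hom[OF g g']] Add_Sub[OF g g'] by simp

lemma Comp_Zero:
  assumes "A \<in> Obj C" and g: "g \<in> Hom C B D"
  shows "g \<cdot> Zero C A B = Zero C A D"
proof -
  have z: "Zero C A B \<in> Hom C A B"
    using assms Zero_Hom Hom_Obj by blast
  \<comment> \<open>Zero is written as the difference 0 - 0, which composition preserves.\<close>
  then have "g \<cdot> Zero C A B = g \<cdot> Sub (Zero C A B) (Zero C A B)"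
    using Sub_eq_Zero_iff[OF z z] by simp
  also have "\<dots> = Zero C A D"
    using Comp_Sub[OF z z g] Sub_eq_Zero_iff[OF Comp_Hom[OF z g] Comp_Hom[OF z g]] by simp
  finally show ?thesis .
qed

lemma Zero_Comp:
  assumes "D \<in> Obj C" and f: "f \<in> Hom C A B"
  shows "Zero C B D \<cdot> f = Zero C A D"
proof -
  have z: "Zero C B D \<in> Hom C B D"
    using assms Zero_Hom Hom_Obj by blast
  then have "Zero C B D \<cdot> f = Sub (Zero C B D) (Zero C B D) \<cdot> f"
    using Sub_eq_Zero_iff[OF z z] by simp
  also have "\<dots> = Zero C A D"
    using Sub_Comp[OF f z z] Sub_eq_Zero_iff[OF Comp_Hom[OF f z] Comp_Hom[OF f z]] by simp
  finally show ?thesis .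
qed

text \<open>Uniqueness of extensions reduces to the case of zero, because the difference of two
  extensions of the same morphism kills \<open>r\<close>.\<close>

lemma universal_arrow_if_zero_cancel:
  assumes "\<B> \<subseteq> Obj C" "R \<in> \<B>" and r: "r \<in> Hom C A R"
    and ex: "\<And>X f. \<lbrakk>X \<in> \<B>; f \<in> Hom C A X\<rbrakk> \<Longrightarrow> \<exists>g \<in> Hom C R X. g \<cdot> r = f"
    and zero: "\<And>X h. \<lbrakk>X \<in> \<B>; h \<in> Hom C R X; h \<cdot> r = Zero C A X\<rbrakk> \<Longrightarrow> h = Zero C R X"
  shows "universal_arrow C \<B> A R r"
proof -
  have "g = h" if "X \<in> \<B>" and g: "g \<in> Hom C R X" and h: "h \<in> Hom C R X" and "g \<cdot> r = h \<cdot> r"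
    for X g h
  proof -
    have "Sub g h \<cdot> r = Zero C A X"
      using Sub_Comp[OF r g h] Sub_eq_Zero_iff[OF Comp_Hom[OF r g] Comp_Hom[OF r h]] that by simp
    then show ?thesis
      using zero[OF that(1) Sub_Hom[OF g h]] Sub_eq_Zero_iff[OF g h] by simp
  qed
  then show ?thesis
    unfolding universal_arrow_def using assms(2) r ex by metis
qed

text \<open>With \<open>e = i p\<close>, the complement of \<open>R\<close> in \<open>K\<close>
  comes from splitting the idempotent \<open>1 - e\<close>.\<close>

lemma split_idempotent_direct_summand:
  assumes "split_idempotents C" and i: "i \<in> Hom C R K" and p: "p \<in> Hom C K R"
    and pi: "p \<cdot> i = Id C R"
  shows "direct_summand C R K"
proof -
  note R = Hom_Obj(1)[OF i] and K = Hom_Obj(2)[OF i]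
  have I: "Id C K \<in> Hom C K K"
    using Id_Hom K by blast
  define e where "e = i \<cdot> p"
  have e: "e \<in> Hom C K K"
    unfolding e_def using Comp_Hom p i by blast
  have pe: "p \<cdot> e = p"
    unfolding e_def using Comp_assoc[OF p i p] pi Id_Comp[OF p] by simp
  have ei: "e \<cdot> i = i"
    unfolding e_def using Comp_assoc[OF i p i] pi Comp_Id[OF i] by simp
  have ee: "e \<cdot> e = e"
    using Comp_assoc[OF e p i] pe unfolding e_def by simp
  define e' where "e' = Sub (Id C K) e"
  have e': "e' \<in> Hom C K K"
    unfolding e'_def using Sub_Hom[OF I e] .
  have pe': "p \<cdot> e' = Zero C K R"
    unfolding e'_def using Comp_Sub[OF I e p] pe Comp_Id[OF p] Sub_eq_Zero_iff[OF p p] by simp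
  have e'i: "e' \<cdot> i = Zero C R K"
    unfolding e'_def using Sub_Comp[OF i I e] ei Id_Comp[OF i] Sub_eq_Zero_iff[OF i i] by simp
  have "e' \<cdot> e = Zero C K K"
    unfolding e'_def using Sub_Comp[OF e I e] ee Id_Comp[OF e] Sub_eq_Zero_iff[OF e e] by simp
  \<comment> \<open>Expanding the second factor gives \<open>e' (1 - e) = e' - e' e\<close>, and the
    last term vanishes.\<close>
  then have "e' \<cdot> e' = Sub e' (Zero C K K)"
    using Comp_Sub[OF I e e'] Comp_Id[OF e'] by (simp add: e'_def)
  also have "\<dots> = e'"
  proof (rule Sub_unique[OF e' Zero_Hom[OF K K] e'])
    interpret G: comm_group "Hom_group C K K"
      using Hom_comm_group[OF K K] .
    show "Zero C K K \<boxplus> e' = e'"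
      using G.l_one[of e'] e' by (simp add: Hom_group_def)
  qed
  finally obtain B q j where B: "B \<in> Obj C" and q: "q \<in> Hom C K B" and j: "j \<in> Hom C B K"
    and qj: "q \<cdot> j = Id C B" and jq: "j \<cdot> q = e'"
    using assms(1) K e' unfolding split_idempotents_def by metis
  \<comment> \<open>As \<open>j\<close> and \<open>q\<close> absorb \<open>e'\<close>, the mixed
    composites \<open>p j\<close> and \<open>q i\<close> inherit the vanishing of
    \<open>p e'\<close> and \<open>e' i\<close>.\<close>
  have e'j: "e' \<cdot> j = j"
    using Comp_assoc[OF j q j] qj jq Comp_Id[OF j] by simp
  have qe': "q \<cdot> e' = q"
    using Comp_assoc[OF q j q] qj jq Id_Comp[OF q] by simp
  have pj: "p \<cdot> j = Zero C B R"
    using Comp_assoc[OF j e' p] e'j pe' Zero_Comp[OF R j] by simp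
  have qi: "q \<cdot> i = Zero C R B"
    using Comp_assoc[OF i e' q] qe' e'i Comp_Zero[OF R q] by simp
  have "(i \<cdot> p) \<boxplus> (j \<cdot> q) = Id C K"
    using Add_Sub[OF I e] jq by (simp add: e'_def e_def)
  then have "biproduct C R B K"
    unfolding biproduct_def using R B K i j p q pi qj pj qi by blast
  then show ?thesis
    unfolding direct_summand_def by blast
qed


subsection \<open>Pseudokernels\<close>

lemma pseudokernelD:
  assumes "pseudokernel C f k" and f: "f \<in> Hom C A B"
  shows "k \<in> Hom C (Dom C k) A" "f \<cdot> k = Zero C (Dom C k) B"
    and "\<And>X h. \<lbrakk>h \<in> Hom C X A; f \<cdot> h = Zero C X B\<rbrakk> \<Longrightarrow> \<exists>u \<in> Hom C X (Dom C k). k \<cdot> u = h"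
  using assms Dom_Obj unfolding pseudokernel_def Hom_def by auto

lemma pseudocokernelD:
  assumes "pseudocokernel C f c" and f: "f \<in> Hom C A B"
  shows "c \<in> Hom C B (Cod C c)" "c \<cdot> f = Zero C A (Cod C c)"
    and "\<And>X h. \<lbrakk>h \<in> Hom C B X; h \<cdot> f = Zero C A X\<rbrakk> \<Longrightarrow> \<exists>u \<in> Hom C (Cod C c) X. u \<cdot> c = h"
  using assms Cod_Obj unfolding pseudocokernel_def Hom_def by auto

text \<open>Extend \<open>k\<close> along \<open>r\<close> to \<open>k'\<close>. As \<open>Y\<close>
  lies in \<open>\<B>\<close>, \<open>r\<close> can be cancelled from \<open>f k' r = 0\<close>, so
  \<open>f k' = 0\<close>. A factorization through \<open>k\<close> becomes one through
  \<open>k'\<close> after composing with \<open>r\<close>.\<close>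

lemma pseudokernel_extend:
  assumes "\<B> \<subseteq> Obj C" and f: "f \<in> Hom C X Y" "X \<in> \<B>" "Y \<in> \<B>" and k: "pseudokernel C f k"
    and U: "universal_arrow C \<B> (Dom C k) R r"
  shows "\<exists>k'. pseudokernel C f k' \<and> Dom C k' \<in> \<B>"
proof -
  note k = pseudokernelD[OF k f(1)]
  note r = universal_arrowD(2)[OF U]
  note R = universal_arrowD(1)[OF U]
  have O: "R \<in> Obj C" "Y \<in> Obj C"
    using R f assms(1) by auto
  obtain k' where k': "k' \<in> Hom C R X" "k' \<cdot> r = k"
    using universal_arrow_factor[OF U f(2) k(1)] .
  have "(f \<cdot> k') \<cdot> r = Zero C R Y \<cdot> r"
    using Comp_assoc[OF r k'(1) f(1)] k' k(2) Zero_Comp[OF O(2) r] by simp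
  then have 0: "f \<cdot> k' = Zero C R Y"
    using universal_arrow_cancel[OF U f(3) Comp_Hom[OF k'(1) f(1)] Zero_Hom[OF O]] by blast
  have "\<exists>u \<in> Hom C Z R. k' \<cdot> u = h" if h: "h \<in> Hom C Z X" "f \<cdot> h = Zero C Z Y" for Z h
  proof -
    obtain u where u: "u \<in> Hom C Z (Dom C k)" "k \<cdot> u = h"
      using k(3)[OF h] by blast
    then have "k' \<cdot> (r \<cdot> u) = h"
      using Comp_assoc[OF u(1) r k'(1)] k'(2) by simp
    then show ?thesis
      using Comp_Hom[OF u(1) r] by blast
  qed
  then have "pseudokernel C f k'"
    using 0 k' f(1) unfolding pseudokernel_def Hom_def by auto
  moreover have "Dom C k' \<in> \<B>"
    using k' R by (simp add: Hom_def)
  ultimately show ?thesis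
    by blast
qed

section \<open>Construction of universal arrows from preenvelopes and pseudokernels\<close>

lemma ex_universal_arrow:
  assumes cok: "\<forall>f \<in> Arr C. \<exists>c. pseudocokernel C f c" and sub: "\<B> \<subseteq> Obj C"
    and split: "split_idempotents C"
    and env: "preenveloping C \<B>" and summand: "closed_under_direct_summands C \<B>"
    and ker: "\<forall>f \<in> Arr (full_subcategory C \<B>). \<exists>k. pseudokernel C f k \<and> Dom C k \<in> \<B>"
    and A: "A \<in> Obj C"
  shows "\<exists>R r. universal_arrow C \<B> A R r"
proof -
  obtain f B where B: "B \<in> \<B>" and f: "f \<in> Hom C A B"
    and f_ext: "\<And>X h. \<lbrakk>X \<in> \<B>; h \<in> Hom C A X\<rbrakk> \<Longrightarrow> \<exists>u \<in> Hom C B X. u \<cdot> f = h"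
    using env A preenvelopeE unfolding preenveloping_def by metis
  obtain c where "pseudocokernel C f c"
    using cok f by (auto simp: Hom_def)
  note c = pseudocokernelD[OF this f]
  obtain g G where G: "G \<in> \<B>" and g: "g \<in> Hom C (Cod C c) G"
    and g_ext: "\<And>X h. \<lbrakk>X \<in> \<B>; h \<in> Hom C (Cod C c) X\<rbrakk> \<Longrightarrow> \<exists>u \<in> Hom C G X. u \<cdot> g = h"
    using env Hom_Obj(2)[OF c(1)] preenvelopeE unfolding preenveloping_def by metis
  define d where "d = g \<cdot> c"
  have d: "d \<in> Hom C B G"
    unfolding d_def using Comp_Hom c g by blast
  have "d \<in> Arr (full_subcategory C \<B>)"
    using d B G by (auto simp: Hom_def)
  then obtain k where "pseudokernel C d k" and K: "Dom C k \<in> \<B>"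
    using ker by blast
  note k = pseudokernelD[OF this(1) d]
  let ?K = "Dom C k"
  have KO: "?K \<in> Obj C"
    using K sub by blast
  have kills: "x \<cdot> k = Zero C ?K X" if X: "X \<in> \<B>" and x: "x \<in> Hom C B X" "x \<cdot> f = Zero C A X" for X x
  proof -
    obtain y where y: "y \<in> Hom C (Cod C c) X" "y \<cdot> c = x"
      using c(3)[OF x] by blast
    obtain z where z: "z \<in> Hom C G X" "z \<cdot> g = y"
      using g_ext[OF X y(1)] by blast
    have "x = z \<cdot> d"
      unfolding d_def using Comp_assoc[OF c(1) g z(1)] y z by simp
    then show ?thesis
      using Comp_assoc[OF k(1) d z(1)] k(2) Comp_Zero[OF KO z(1)] by simp
  qed
  have "d \<cdot> f = Zero C A G"
    unfolding d_def using Comp_assoc[OF f c(1) g] c(2) Comp_Zero[OF A g] by simp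
  then obtain f' where f': "f' \<in> Hom C A ?K" "k \<cdot> f' = f"
    using k(3)[OF f] by blast
  obtain s where s: "s \<in> Hom C B ?K" "s \<cdot> f = f'"
    using f_ext[OF K f'(1)] by blast
  define e where "e = s \<cdot> k"
  have e: "e \<in> Hom C ?K ?K"
    unfolding e_def using Comp_Hom k s by blast
  have ef': "e \<cdot> f' = f'"
    unfolding e_def using Comp_assoc[OF f'(1) k(1) s(1)] f' s by simp
  \<comment> \<open>Since \<open>s f = f'\<close>, the morphism \<open>h s\<close> kills
    \<open>f\<close>; applying \<open>kills\<close> to it gives \<open>h s k = 0\<close>.\<close>
  have kills_e: "h \<cdot> e = Zero C ?K X"
    if X: "X \<in> \<B>" and h: "h \<in> Hom C ?K X" "h \<cdot> f' = Zero C A X" for X h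
  proof -
    have "(h \<cdot> s) \<cdot> f = Zero C A X"
      using Comp_assoc[OF f s(1) h(1)] s h by simp
    then show ?thesis
      using kills[OF X Comp_Hom[OF s(1) h(1)]] Comp_assoc[OF k(1) s(1) h(1)] unfolding e_def by simp
  qed
  have I: "Id C ?K \<in> Hom C ?K ?K"
    using Id_Hom[OF KO] .
  \<comment> \<open>\<open>kills_e\<close> is applied to \<open>1 - e\<close>, a morphism into
    \<open>?K\<close>, which lies in \<open>\<B>\<close>; hence
    \<open>(1 - e) e = 0\<close>.\<close>
  have "Sub (Id C ?K) e \<cdot> f' = Zero C A ?K"
    using Sub_Comp[OF f'(1) I e] ef' Id_Comp[OF f'(1)] Sub_eq_Zero_iff[OF f'(1) f'(1)] by simp
  then have "Sub e (e \<cdot> e) = Zero C ?K ?K"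
    using kills_e[OF K Sub_Hom[OF I e]] Sub_Comp[OF e I e] Id_Comp[OF e] by simp
  then have "e \<cdot> e = e"
    using Sub_eq_Zero_iff[OF e Comp_Hom[OF e e]] by simp
  then obtain R p i where p: "p \<in> Hom C ?K R" and i: "i \<in> Hom C R ?K"
    and pi: "p \<cdot> i = Id C R" and ip: "i \<cdot> p = e"
    using split KO e unfolding split_idempotents_def by metis
  have R: "R \<in> \<B>"
    using split_idempotent_direct_summand[OF split i p pi] summand K
    unfolding closed_under_direct_summands_def by blast
  define r where "r = p \<cdot> f'"
  have r: "r \<in> Hom C A R"
    unfolding r_def using Comp_Hom f' p by blast
  have ir: "i \<cdot> r = f'"
    unfolding r_def using Comp_assoc[OF f'(1) p i] ip ef' by simp
  have "universal_arrow C \<B> A R r"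
  proof (rule universal_arrow_if_zero_cancel[OF sub R r])
    fix X h assume X: "X \<in> \<B>" and h: "h \<in> Hom C A X"
    obtain u where u: "u \<in> Hom C B X" "u \<cdot> f = h"
      using f_ext[OF X h] by blast
    have uk: "u \<cdot> k \<in> Hom C ?K X"
      using Comp_Hom k u by blast
    \<comment> \<open>The extension of \<open>h\<close> is \<open>u k i\<close>, because
      \<open>k i r = k f' = f\<close>.\<close>
    have "((u \<cdot> k) \<cdot> i) \<cdot> r = h"
      using Comp_assoc[OF r i uk] Comp_assoc[OF f'(1) k(1) u(1)] ir f' u by simp
    then show "\<exists>g \<in> Hom C R X. g \<cdot> r = h"
      using Comp_Hom[OF i uk] by blast
  next
    fix X h assume X: "X \<in> \<B>" and h: "h \<in> Hom C R X" "h \<cdot> r = Zero C A X"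
    have hp: "h \<cdot> p \<in> Hom C ?K X"
      using Comp_Hom p h by blast
    \<comment> \<open>Two evaluations of \<open>h p e\<close> are compared: it is zero by
      \<open>kills_e\<close>, and it equals \<open>h p\<close> because \<open>e = i p\<close> and
      \<open>p i = 1\<close>. Composing \<open>h p = 0\<close> with \<open>i\<close> then recovers
      \<open>h = 0\<close>.\<close>
    have "(h \<cdot> p) \<cdot> f' = Zero C A X"
      using Comp_assoc[OF f'(1) p h(1)] h unfolding r_def by simp
    then have "(h \<cdot> p) \<cdot> e = Zero C ?K X"
      using kills_e[OF X hp] by simp
    moreover have "(h \<cdot> p) \<cdot> i = h"
      using Comp_assoc[OF i p h(1)] pi Comp_Id[OF h(1)] by simp
    then have "(h \<cdot> p) \<cdot> e = h \<cdot> p"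
      using Comp_assoc[OF p i hp] ip by simp
    ultimately have "h \<cdot> p = Zero C ?K X"
      by simp
    then show "h = Zero C R X"
      using \<open>(h \<cdot> p) \<cdot> i = h\<close> Zero_Comp[OF _ i] Hom_Obj(2)[OF h(1)] by simp
  qed
  then show ?thesis
    by blast
qed

end

theorem theorem3p2:
  fixes C :: "('o, 'm, 'r) add_cat_scheme" and \<B> :: "'o set"
  assumes "additive_category C"
    and "\<forall>f \<in> Arr C. \<exists>k. pseudokernel C f k"
    and "\<forall>f \<in> Arr C. \<exists>c. pseudocokernel C f c"
    and "replete C \<B>"
  shows
    "(reflective C \<B> \<longrightarrow>
        preenveloping C \<B> \<and> closed_under_direct_summands C \<B> \<and>
        (\<forall>f \<in> Arr (full_subcategory C \<B>). \<exists>k. pseudokernel C f k \<and> Dom C k \<in> \<B>)) \<and>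
     (split_idempotents C \<longrightarrow>
        preenveloping C \<B> \<and> closed_under_direct_summands C \<B> \<and>
        (\<forall>f \<in> Arr (full_subcategory C \<B>). \<exists>k. pseudokernel C f k \<and> Dom C k \<in> \<B>) \<longrightarrow>
        reflective C \<B>)"
proof -
  interpret additive_category C by (rule assms(1))
  have sub: "\<B> \<subseteq> Obj C"
    using assms(4) by (simp add: replete_def)
  \<comment> \<open>The injection and projection of a biproduct exhibit a direct summand as a
    retract.\<close>
  have "closed_under_direct_summands C \<B>"
    if U: "\<And>A. A \<in> Obj C \<Longrightarrow> \<exists>R r. universal_arrow C \<B> A R r"
    unfolding closed_under_direct_summands_def direct_summand_def biproduct_def
    using universal_arrow_retract[OF assms(4)] U by blast
  moreover have "\<exists>k. pseudokernel C f k \<and> Dom C k \<in> \<B>"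
    if U: "\<And>A. A \<in> Obj C \<Longrightarrow> \<exists>R r. universal_arrow C \<B> A R r"
      and f: "f \<in> Arr (full_subcategory C \<B>)" for f
  proof -
    have f': "f \<in> Hom C (Dom C f) (Cod C f)" "Dom C f \<in> \<B>" "Cod C f \<in> \<B>"
      using f by (auto simp: Hom_def)
    obtain k where k: "pseudokernel C f k"
      using assms(2) f by auto
    \<comment> \<open>The pseudokernel in \<open>C\<close> may start outside \<open>\<B>\<close>;
      the universal arrow of its domain is used to replace it.\<close>
    then obtain R r where "universal_arrow C \<B> (Dom C k) R r"
      using U Dom_Obj unfolding pseudokernel_def by blast
    then show ?thesis
      by (rule pseudokernel_extend[OF sub f' k])
  qed
  ultimately show ?thesis
    using reflective_imp_universal_arrow[of \<B>] preenveloping_if_universal_arrows[of \<B>]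
      universal_arrows_imp_reflective[OF sub] ex_universal_arrow[OF assms(3) sub]
    by (intro conjI impI ballI) blast+
qed

end
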